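(* Let $G$ be a connected simple graph on $n$ vertices and let $\Phi=\{\phi_i\}_{i\in[n]}$ be an $L_G(n,n-1)$-frame for $\mathbb{C}^{n-1}$ with frame operator $S_\Phi$. Then for every $r\in[n-1]$, the canonical dual frame $S_\Phi^{-1}\Phi$ is the unique $SOD$-frame of $\Phi$ for $r$-erasures.
   Context: $[n]=\{1,\dots,n\}$. A finite sequence $\Phi=\{\phi_i\}_{i\in[n]}$ in $\mathbb{C}^m$ is a frame for $\mathbb{C}^m$ if there are constants $0<A\le B$ with $A\|f\|^2\le\sum_{i\in[n]}|\langle f,\phi_i\rangle|^2\le B\|f\|^2$ for all $f\in\mathbb{C}^m$ (inner product linear in the first argument). Its frame operator is $S_\Phi f=\sum_{i\in[n]}\langle f,\phi_i\rangle\phi_i$, which is invertible. A frame $\Psi=\{\psi_i\}_{i\in[n]}$ for $\mathbb{C}^m$ is a dual frame of $\Phi$ if $f=\sum_{i\in[n]}\langle f,\phi_i\rangle\psi_i=\sum_{i\in[n]}\langle f,\psi_i\rangle\phi_i$ for all $f\in\mathbb{C}^m$; $D_\Phi$ denotes the set of all dual frames of $\Phi$. The canonical dual frame is $S_\Phi^{-1}\Phi=\{S_\Phi^{-1}\phi_i\}_{i\in[n]}$. For a frame $\Phi$, $\Psi\in D_\Phi$ and $\Lambda\subset[n]$, the error operator is $E_{\Phi,\Psi,\Lambda}:\mathbb{C}^m\to\mathbb{C}^m$, $E_{\Phi,\Psi,\Lambda}(f)=\sum_{i\in\Lambda}\langle f,\phi_i\rangle\psi_i$. For $1\le r<n$,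 $\rho^{(r)}_{\Phi,\Psi}=\max\{\rho(E_{\Phi,\Psi,\Lambda}):\Lambda\subset[n],\ |\Lambda|=r\}$, where $\rho(\cdot)$ denotes the spectral radius. $SOD$-frames (spectrally optimal dual frames) are defined inductively: $\Psi\in D_\Phi$ is an $SOD$-frame of $\Phi$ for $1$-erasure if $\rho^{(1)}_{\Phi,\Psi}=\min\{\rho^{(1)}_{\Phi,\widetilde\Psi}:\widetilde\Psi\in D_\Phi\}$; for $1<r<n$, $\Psi\in D_\Phi$ is an $SOD$-frame of $\Phi$ for $r$-erasures if it is an $SOD$-frame of $\Phi$ for $(r-1)$-erasures and $\rho^{(r)}_{\Phi,\Psi}=\min\{\rho^{(r)}_{\Phi,\widetilde\Psi}:\widetilde\Psi\in D_\Phi\}$ (the minimum being over all dual frames of $\Phi$). For a simple graph $G$ with vertices $v_1,\dots,v_n$, the Laplacian matrix is $L=D-A$, with $D$ the diagonal matrix of vertex degrees and $A$ the adjacency matrix. It is positive semidefinite, and if $G$ has $n-m$ connected components then $L$ has rank $m$. $L_G(n,m)$-frame: let $G$ be a simple graph on $n$ vertices with $n-m$ connected components, and write $L=M\,\mathrm{diag}(\lambda_1,\dots,\lambda_m,0,\dots,0)\,M^*$ with $M$ an $n\times n$ unitary matrix and $\lambda_1,\dots,\lambda_m$ the nonzero eigenvalues of $L$ (with multiplicity). Let $M_1$ be the submatrix of $M$ formed by its first $m$ columns, $B=\mathrm{diag}(\sqrt{\lambda_1},\dots,\sqrt{\lambda_m})M_1^*$, and $\{e_i\}_{i\in[n]}$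 the standard basis of $\mathbb{C}^n$. Then $\{Be_i\}_{i\in[n]}$ is a frame for $\mathbb{C}^m$; any frame arising in this way is called an $L_G(n,m)$-frame for $\mathbb{C}^m$. *)

theory Defs
  imports
    "Jordan_Normal_Form.Schur_Decomposition"
    "Jordan_Normal_Form.Spectral_Radius"
    "Graph_Theory.Graph_Theory"
begin

text \<open>
  A finite sequence of vectors is a list \<open>\<Phi>\<close>, so its length is \<open>n\<close> and the index set
  \<open>{1,\<dots>,n}\<close> becomes \<open>{..<n}\<close>. The inner product \<open>x \<bullet>c y\<close> is conjugate-linear in the
  second argument, and \<open>Re (f \<bullet>c f)\<close> is the squared Hilbert space norm of \<open>f\<close>.
\<close>

definition is_frame :: "nat \<Rightarrow> complex vec list \<Rightarrow> bool" where
  "is_frame m \<Phi> \<longleftrightarrow> set \<Phi> \<subseteq> carrier_vec m \<and>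
     (\<exists>A B :: real. 0 < A \<and> A \<le> B \<and>
        (\<forall>f \<in> carrier_vec m.
           A * Re (f \<bullet>c f) \<le> (\<Sum>i<length \<Phi>. (cmod (f \<bullet>c (\<Phi> ! i)))\<^sup>2) \<and>
           (\<Sum>i<length \<Phi>. (cmod (f \<bullet>c (\<Phi> ! i)))\<^sup>2) \<le> B * Re (f \<bullet>c f)))"

definition error_op ::
  "nat \<Rightarrow> complex vec list \<Rightarrow> complex vec list \<Rightarrow> nat set \<Rightarrow> complex vec \<Rightarrow> complex vec" where
  "error_op m \<Phi> \<Psi> \<Lambda> f =
     finsum_vec TYPE(complex) m (\<lambda>i. (f \<bullet>c (\<Phi> ! i)) \<cdot>\<^sub>v (\<Psi> ! i)) \<Lambda>"

definition frame_op :: "nat \<Rightarrow> complex vec list \<Rightarrow> complex vec \<Rightarrow> complex vec" where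
  "frame_op m \<Phi> f =
     finsum_vec TYPE(complex) m (\<lambda>i. (f \<bullet>c (\<Phi> ! i)) \<cdot>\<^sub>v (\<Phi> ! i)) {..<length \<Phi>}"

definition dual_frames :: "nat \<Rightarrow> complex vec list \<Rightarrow> complex vec list set" where
  "dual_frames m \<Phi> = {\<Psi>. length \<Psi> = length \<Phi> \<and> is_frame m \<Psi> \<and>
     (\<forall>f \<in> carrier_vec m.
        f = finsum_vec TYPE(complex) m (\<lambda>i. (f \<bullet>c (\<Phi> ! i)) \<cdot>\<^sub>v (\<Psi> ! i)) {..<length \<Phi>} \<and>
        f = finsum_vec TYPE(complex) m (\<lambda>i. (f \<bullet>c (\<Psi> ! i)) \<cdot>\<^sub>v (\<Phi> ! i)) {..<length \<Phi>})}"

definition canonical_dual :: "nat \<Rightarrow> complex vec list \<Rightarrow> complex vec list" where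
  "canonical_dual m \<Phi> = map (the_inv_into (carrier_vec m) (frame_op m \<Phi>)) \<Phi>"

text \<open>The library's spectral radius is that of a matrix, so an operator on \<open>\<complex>\<^sup>m\<close> is passed
  through its matrix in the standard basis.\<close>

definition op_matrix :: "nat \<Rightarrow> (complex vec \<Rightarrow> complex vec) \<Rightarrow> complex mat" where
  "op_matrix m T = mat_of_cols m (map (\<lambda>j. T (unit_vec m j)) [0..<m])"

definition erasure_radius ::
  "nat \<Rightarrow> complex vec list \<Rightarrow> nat \<Rightarrow> complex vec list \<Rightarrow> real" where
  "erasure_radius m \<Phi> r \<Psi> =
     Max ((\<lambda>\<Lambda>. spectral_radius (op_matrix m (error_op m \<Phi> \<Psi> \<Lambda>)))
          ` {\<Lambda>. \<Lambda> \<subseteq> {..<length \<Phi>} \<and> card \<Lambda> = r})"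

text \<open>\<open>is_arg_min f P x\<close> says that \<open>P x\<close> holds and that \<open>f\<close> attains at \<open>x\<close> its minimum over \<open>P\<close>.\<close>

inductive SOD_frame :: "nat \<Rightarrow> complex vec list \<Rightarrow> nat \<Rightarrow> complex vec list \<Rightarrow> bool"
  for m \<Phi> where
  one: "\<lbrakk> 1 < length \<Phi>;
          is_arg_min (erasure_radius m \<Phi> 1) (\<lambda>\<Psi>. \<Psi> \<in> dual_frames m \<Phi>) \<Psi> \<rbrakk>
        \<Longrightarrow> SOD_frame m \<Phi> 1 \<Psi>"
| step: "\<lbrakk> 1 < r; r < length \<Phi>; SOD_frame m \<Phi> (r - 1) \<Psi>;
          is_arg_min (erasure_radius m \<Phi> r) (\<lambda>\<Psi>. \<Psi> \<in> dual_frames m \<Phi>) \<Psi> \<rbrakk>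
        \<Longrightarrow> SOD_frame m \<Phi> r \<Psi>"

text \<open>A simple graph is a \<open>pair_graph\<close>: a finite loop-free symmetric relation on its vertices.
  Hence the degree of a vertex is its out-degree, and the connected components are the
  strongly connected ones. The map \<open>v\<close> enumerates the vertices as \<open>v 0, \<dots>, v (n - 1)\<close>.\<close>

definition laplacian :: "nat \<Rightarrow> 'v pair_pre_digraph \<Rightarrow> (nat \<Rightarrow> 'v) \<Rightarrow> complex mat" where
  "laplacian n G v =
     mat_diag n (\<lambda>i. of_nat (out_degree (with_proj G) (v i))) -
     mat n n (\<lambda>(i, j). if (v i, v j) \<in> parcs G then 1 else 0)"

definition unitary_mat :: "nat \<Rightarrow> complex mat \<Rightarrow> bool" where
  "unitary_mat n M \<longleftrightarrow> M \<in> carrier_mat n n \<and>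
     M * mat_adjoint M = 1\<^sub>m n \<and> mat_adjoint M * M = 1\<^sub>m n"

definition is_LG_frame ::
  "nat \<Rightarrow> nat \<Rightarrow> 'v pair_pre_digraph \<Rightarrow> complex vec list \<Rightarrow> bool" where
  "is_LG_frame n m G \<Phi> \<longleftrightarrow>
     pair_graph G \<and> card (pverts G) = n \<and>
     m \<le> n \<and> card (pre_digraph.sccs_verts (with_proj G)) = n - m \<and>
     (\<exists>(v :: nat \<Rightarrow> 'v) (M :: complex mat) (l :: nat \<Rightarrow> real).
        bij_betw v {..<n} (pverts G) \<and>
        unitary_mat n M \<and> (\<forall>i<m. l i \<noteq> 0) \<and>
        laplacian n G v =
          M * mat_diag n (\<lambda>i. if i < m then complex_of_real (l i) else 0) * mat_adjoint M \<and>
        (let M1 = mat n m (\<lambda>(i, j). M $$ (i, j));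
             B = mat_diag m (\<lambda>i. complex_of_real (sqrt (l i))) * mat_adjoint M1
         in \<Phi> = map (\<lambda>i. B *\<^sub>v unit_vec n i) [0..<n]))"

end

theory Submission
  imports Defs
begin

text \<open>
  The Gram matrix of an \<open>L\<^sub>G(n, n - 1)\<close>-frame \<open>\<Phi>\<close> is the Laplacian, whose kernel is spanned by the
  all-ones vector. Hence \<open>\<Sum>\<^sub>i \<phi>\<^sub>i = 0\<close>, the only linear relations among the \<open>\<phi>\<^sub>i\<close> are the multiples
  of this one, and every dual frame is a translate \<open>\<psi>\<^sub>i = S\<^sup>-\<^sup>1 \<phi>\<^sub>i + h\<close> of the canonical one, with
  \<open>\<langle>\<psi>\<^sub>j, \<phi>\<^sub>i\<rangle> = \<delta>\<^sub>i\<^sub>j - 1/n + \<langle>h, \<phi>\<^sub>i\<rangle>\<close>. The spectral radius for the erasure of \<open>i\<close> is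
  \<open>|1 - 1/n + \<langle>h, \<phi>\<^sub>i\<rangle>|\<close>; since the \<open>\<langle>h, \<phi>\<^sub>i\<rangle>\<close> sum to zero, the maximum over \<open>i\<close> is at least
  \<open>1 - 1/n\<close>, with equality only for \<open>h = 0\<close>. For \<open>r \<ge> 2\<close> every dual frame has radius at least \<open>1\<close>,
  because \<open>\<psi>\<^sub>i - \<psi>\<^sub>j\<close> is fixed by the error operator of any set containing \<open>i\<close> and \<open>j\<close>, and for the
  canonical dual the radius is at most \<open>1\<close>. So uniqueness is settled at the first level and the
  canonical dual stays optimal at all later ones.
\<close>

section \<open>Spectral radii of error operators\<close>

lemma cscalar_prod_sum:
  assumes "x \<in> carrier_vec m" "y \<in> carrier_vec m"
  shows "x \<bullet>c y = (\<Sum>k<m. x $ k * cnj (y $ k))"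
proof -
  have "x \<bullet>c y = (\<Sum>k<m. x $ k * conjugate y $ k)"
    using assms by (simp add: scalar_prod_def lessThan_atLeast0)
  also have "\<dots> = (\<Sum>k<m. x $ k * cnj (y $ k))"
    using assms by (intro sum.cong refl) simp
  finally show ?thesis .
qed

lemma index_finsum_smult_vec:
  fixes \<Psi> :: "complex vec list"
  assumes "finite \<Lambda>" "\<And>i. i \<in> \<Lambda> \<Longrightarrow> \<Psi> ! i \<in> carrier_vec m" "k < m"
  shows "finsum_vec TYPE(complex) m (\<lambda>i. c i \<cdot>\<^sub>v (\<Psi> ! i)) \<Lambda> $ k = (\<Sum>i\<in>\<Lambda>. c i * \<Psi> ! i $ k)"
proof -
  have "finsum_vec TYPE(complex) m (\<lambda>i. c i \<cdot>\<^sub>v (\<Psi> ! i)) \<Lambda> $ k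
      = (\<Sum>i\<in>\<Lambda>. (c i \<cdot>\<^sub>v (\<Psi> ! i)) $ k)"
    using assms by (intro index_finsum_vec) auto
  also have "\<dots> = (\<Sum>i\<in>\<Lambda>. c i * \<Psi> ! i $ k)"
  proof (intro sum.cong refl)
    fix i assume "i \<in> \<Lambda>"
    then show "(c i \<cdot>\<^sub>v (\<Psi> ! i)) $ k = c i * \<Psi> ! i $ k"
      using assms(2)[of i] assms(3) by simp
  qed
  finally show ?thesis .
qed

lemma finsum_smult_vec_closed:
  fixes \<Psi> :: "complex vec list"
  assumes "\<And>i. i \<in> \<Lambda> \<Longrightarrow> \<Psi> ! i \<in> carrier_vec m"
  shows "finsum_vec TYPE(complex) m (\<lambda>i. c i \<cdot>\<^sub>v (\<Psi> ! i)) \<Lambda> \<in> carrier_vec m"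
  using assms by (intro finsum_vec_closed) auto

lemma finsum_smult_vec_eq_iff:
  fixes \<Psi> :: "complex vec list"
  assumes "finite \<Lambda>" "\<And>i. i \<in> \<Lambda> \<Longrightarrow> \<Psi> ! i \<in> carrier_vec m" "f \<in> carrier_vec m"
  shows "f = finsum_vec TYPE(complex) m (\<lambda>i. c i \<cdot>\<^sub>v (\<Psi> ! i)) \<Lambda>
    \<longleftrightarrow> (\<forall>k<m. (\<Sum>i\<in>\<Lambda>. c i * \<Psi> ! i $ k) = f $ k)"
proof -
  let ?g = "finsum_vec TYPE(complex) m (\<lambda>i. c i \<cdot>\<^sub>v (\<Psi> ! i)) \<Lambda>"
  have "?g \<in> carrier_vec m"
    using assms(2) by (rule finsum_smult_vec_closed)
  then have "dim_vec ?g = m" by (rule carrier_vecD)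
  with assms(3) have "f = ?g \<longleftrightarrow> (\<forall>k<m. f $ k = ?g $ k)"
    by (simp add: vec_eq_iff carrier_vecD[OF assms(3)])
  also have "\<dots> \<longleftrightarrow> (\<forall>k<m. (\<Sum>i\<in>\<Lambda>. c i * \<Psi> ! i $ k) = f $ k)"
    by (intro all_cong) (subst index_finsum_smult_vec[OF assms(1,2)], auto)
  finally show ?thesis .
qed

section \<open>Error operators and their eigenvalues\<close>

context
  fixes m :: nat and \<Phi> \<Psi> :: "complex vec list" and \<Lambda> :: "nat set"
  assumes fin: "finite \<Lambda>"
    and \<Phi>: "\<And>i. i \<in> \<Lambda> \<Longrightarrow> \<Phi> ! i \<in> carrier_vec m"
    and \<Psi>: "\<And>i. i \<in> \<Lambda> \<Longrightarrow> \<Psi> ! i \<in> carrier_vec m"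
begin

lemma op_matrix_error_op_mult:
  assumes f: "f \<in> carrier_vec m"
  shows "op_matrix m (error_op m \<Phi> \<Psi> \<Lambda>) *\<^sub>v f = error_op m \<Phi> \<Psi> \<Lambda> f"
proof (rule eq_vecI)
  have c: "dim_vec (error_op m \<Phi> \<Psi> \<Lambda> g) = m" for g
    unfolding error_op_def using \<Psi> by (intro carrier_vecD finsum_smult_vec_closed)
  show "dim_vec (op_matrix m (error_op m \<Phi> \<Psi> \<Lambda>) *\<^sub>v f) = dim_vec (error_op m \<Phi> \<Psi> \<Lambda> f)"
    unfolding c by (simp add: op_matrix_def)
  fix k assume "k < dim_vec (error_op m \<Phi> \<Psi> \<Lambda> f)"
  then have k: "k < m" unfolding c .
  have 0: "error_op m \<Phi> \<Psi> \<Lambda> g $ k = (\<Sum>i\<in>\<Lambda>. (g \<bullet>c \<Phi> ! i) * \<Psi> ! i $ k)" for g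
    unfolding error_op_def using fin \<Psi> k by (rule index_finsum_smult_vec)
  have 1: "error_op m \<Phi> \<Psi> \<Lambda> f $ k = (\<Sum>i\<in>\<Lambda>. (\<Sum>j<m. f $ j * cnj (\<Phi> ! i $ j)) * \<Psi> ! i $ k)"
    unfolding 0 using \<Phi> by (intro sum.cong refl arg_cong2[where f="(*)"] cscalar_prod_sum f)
  have 2: "error_op m \<Phi> \<Psi> \<Lambda> (unit_vec m j) $ k = (\<Sum>i\<in>\<Lambda>. cnj (\<Phi> ! i $ j) * \<Psi> ! i $ k)"
    if "j < m" for j
    unfolding 0
  proof (intro sum.cong refl arg_cong2[where f="(*)"])
    fix i assume "i \<in> \<Lambda>"
    from \<Phi>[OF this] that show "unit_vec m j \<bullet>c \<Phi> ! i = cnj (\<Phi> ! i $ j)" by simp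
  qed
  have "(op_matrix m (error_op m \<Phi> \<Psi> \<Lambda>) *\<^sub>v f) $ k
      = (\<Sum>j<m. error_op m \<Phi> \<Psi> \<Lambda> (unit_vec m j) $ k * f $ j)"
    using f k by (auto simp: op_matrix_def scalar_prod_def mat_of_cols_index lessThan_atLeast0
        intro!: sum.cong)
  also have "\<dots> = (\<Sum>j<m. (\<Sum>i\<in>\<Lambda>. f $ j * cnj (\<Phi> ! i $ j) * \<Psi> ! i $ k))"
    by (intro sum.cong refl) (simp add: 2 sum_distrib_left sum_distrib_right mult_ac)
  also have "\<dots> = error_op m \<Phi> \<Psi> \<Lambda> f $ k"
    by (subst 1, subst sum.swap) (simp add: sum_distrib_right)
  finally show "(op_matrix m (error_op m \<Phi> \<Psi> \<Lambda>) *\<^sub>v f) $ k = error_op m \<Phi> \<Psi> \<Lambda> f $ k" .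
qed

text \<open>The matrix acts on every vector as the error operator does, so the eigenvector equation
  can be read coordinate by coordinate.\<close>

lemma eigenvalue_error_op_iff:
  "eigenvalue (op_matrix m (error_op m \<Phi> \<Psi> \<Lambda>)) x \<longleftrightarrow>
    (\<exists>f \<in> carrier_vec m. f \<noteq> 0\<^sub>v m \<and> (\<forall>k<m. (\<Sum>i\<in>\<Lambda>. (f \<bullet>c (\<Phi> ! i)) * \<Psi> ! i $ k) = x * f $ k))"
proof -
  have "dim_row (op_matrix m (error_op m \<Phi> \<Psi> \<Lambda>)) = m"
    by (simp add: op_matrix_def)
  moreover have "op_matrix m (error_op m \<Phi> \<Psi> \<Lambda>) *\<^sub>v f = x \<cdot>\<^sub>v f \<longleftrightarrow>
      (\<forall>k<m. (\<Sum>i\<in>\<Lambda>. (f \<bullet>c (\<Phi> ! i)) * \<Psi> ! i $ k) = x * f $ k)" if f: "f \<in> carrier_vec m" for f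
  proof -
    have "op_matrix m (error_op m \<Phi> \<Psi> \<Lambda>) *\<^sub>v f = x \<cdot>\<^sub>v f \<longleftrightarrow> x \<cdot>\<^sub>v f = error_op m \<Phi> \<Psi> \<Lambda> f"
      unfolding op_matrix_error_op_mult[OF f] by (rule eq_commute)
    also have "\<dots> \<longleftrightarrow> (\<forall>k<m. (\<Sum>i\<in>\<Lambda>. (f \<bullet>c (\<Phi> ! i)) * \<Psi> ! i $ k) = (x \<cdot>\<^sub>v f) $ k)"
      unfolding error_op_def using f by (intro finsum_smult_vec_eq_iff[OF fin \<Psi>]) simp_all
    also have "\<dots> \<longleftrightarrow> (\<forall>k<m. (\<Sum>i\<in>\<Lambda>. (f \<bullet>c (\<Phi> ! i)) * \<Psi> ! i $ k) = x * f $ k)"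
      by (simp add: carrier_vecD[OF f])
    finally show ?thesis .
  qed
  ultimately show ?thesis
    unfolding eigenvalue_def eigenvector_def Bex_def by (simp cong: conj_cong)
qed

end

section \<open>Bounds for spectral and erasure radii\<close>

lemma spectral_radius_ge:
  assumes "A \<in> carrier_mat m m" "0 < m" "eigenvalue A x"
  shows "cmod x \<le> spectral_radius A"
  using spectral_radius_mem_max(2)[OF assms(1,2)] assms(3) by (simp add: spectrum_def)

lemma spectral_radius_le:
  assumes "A \<in> carrier_mat m m" "0 < m" "\<And>x. eigenvalue A x \<Longrightarrow> cmod x \<le> b"
  shows "spectral_radius A \<le> b"
  using spectral_radius_mem_max(1)[OF assms(1,2)] assms(3) by (auto simp: spectrum_def)

lemma op_matrix_carrier: "op_matrix m T \<in> carrier_mat m m"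
  unfolding op_matrix_def by (rule carrier_matI) simp_all

lemma finite_index_sets: "finite {\<Lambda>. \<Lambda> \<subseteq> {..<n::nat} \<and> card \<Lambda> = r}"
  by (rule finite_subset[of _ "Pow {..<n}"]) auto

lemma erasure_radius_ge:
  assumes "\<Lambda> \<subseteq> {..<length \<Phi>}" "card \<Lambda> = r"
  shows "spectral_radius (op_matrix m (error_op m \<Phi> \<Psi> \<Lambda>)) \<le> erasure_radius m \<Phi> r \<Psi>"
  unfolding erasure_radius_def using assms finite_index_sets
  by (intro Max_ge) auto

lemma erasure_radius_le:
  assumes "r \<le> length \<Phi>"
    and "\<And>\<Lambda>. \<Lambda> \<subseteq> {..<length \<Phi>} \<Longrightarrow> card \<Lambda> = r \<Longrightarrow>
      spectral_radius (op_matrix m (error_op m \<Phi> \<Psi> \<Lambda>)) \<le> b"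
  shows "erasure_radius m \<Phi> r \<Psi> \<le> b"
proof -
  have "{..<r} \<in> {\<Lambda>. \<Lambda> \<subseteq> {..<length \<Phi>} \<and> card \<Lambda> = r}"
    using assms(1) by auto
  then have "{\<Lambda>. \<Lambda> \<subseteq> {..<length \<Phi>} \<and> card \<Lambda> = r} \<noteq> {}" by blast
  then show ?thesis
    unfolding erasure_radius_def using assms(2) finite_index_sets
    by (subst Max_le_iff) auto
qed

text \<open>The operator has rank at most one and range in the span of \<open>\<Psi> ! i\<close>, so
  its only possible nonzero eigenvalue is the factor by which it scales
  \<open>\<Psi> ! i\<close>.\<close>

lemma spectral_radius_error_op_singleton:
  assumes "0 < m" "\<Phi> ! i \<in> carrier_vec m" "\<Psi> ! i \<in> carrier_vec m"
  shows "spectral_radius (op_matrix m (error_op m \<Phi> \<Psi> {i})) = cmod (\<Psi> ! i \<bullet>c \<Phi> ! i)"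
proof (rule antisym)
  note iff = eigenvalue_error_op_iff[of "{i}" \<Phi> m \<Psi>, simplified, OF assms(2,3)]
  show "spectral_radius (op_matrix m (error_op m \<Phi> \<Psi> {i})) \<le> cmod (\<Psi> ! i \<bullet>c \<Phi> ! i)"
  proof (rule spectral_radius_le[OF op_matrix_carrier \<open>0 < m\<close>])
    fix x assume "eigenvalue (op_matrix m (error_op m \<Phi> \<Psi> {i})) x"
    then obtain f where f: "f \<in> carrier_vec m" "f \<noteq> 0\<^sub>v m"
      and eig: "\<And>k. k < m \<Longrightarrow> (f \<bullet>c \<Phi> ! i) * \<Psi> ! i $ k = x * f $ k"
      unfolding iff by blast
    \<comment> \<open>Pair the eigenvector equation with \<open>\<Phi> ! i\<close>; a nonzero
      \<open>f \<bullet>c \<Phi> ! i\<close> then cancels.\<close>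
    have "(f \<bullet>c \<Phi> ! i) * (\<Psi> ! i \<bullet>c \<Phi> ! i) = x * (f \<bullet>c \<Phi> ! i)"
    proof -
      have "(f \<bullet>c \<Phi> ! i) * (\<Psi> ! i \<bullet>c \<Phi> ! i)
          = (\<Sum>k<m. (f \<bullet>c \<Phi> ! i) * \<Psi> ! i $ k * cnj (\<Phi> ! i $ k))"
        using assms by (simp add: cscalar_prod_sum[of "\<Psi> ! i" m] sum_distrib_left mult.assoc)
      also have "\<dots> = (\<Sum>k<m. x * (f $ k * cnj (\<Phi> ! i $ k)))"
        by (intro sum.cong refl) (simp add: eig)
      also have "\<dots> = x * (f \<bullet>c \<Phi> ! i)"
        using assms f(1) by (simp add: cscalar_prod_sum[of f m] sum_distrib_left)
      finally show ?thesis .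
    qed
    moreover have "x = 0" if "f \<bullet>c \<Phi> ! i = 0"
    proof -
      obtain k where "k < m" "f $ k \<noteq> 0"
        using f by (metis carrier_vecD eq_vecI index_zero_vec)
      then show ?thesis using eig[of k] that by auto
    qed
    ultimately show "cmod x \<le> cmod (\<Psi> ! i \<bullet>c \<Phi> ! i)"
      by (cases "x = 0") (auto simp: mult.commute)
  qed
  show "cmod (\<Psi> ! i \<bullet>c \<Phi> ! i) \<le> spectral_radius (op_matrix m (error_op m \<Phi> \<Psi> {i}))"
  proof (cases "\<Psi> ! i \<bullet>c \<Phi> ! i = 0")
    \<comment> \<open>Here \<open>\<Psi> ! i\<close> may be zero and thus no eigenvector, but the
      bound is just nonnegativity of the spectral radius.\<close>
    case True
    have "0 \<le> spectral_radius (op_matrix m (error_op m \<Phi> \<Psi> {i}))"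
      by (metis spectral_radius_mem_max(1)[OF op_matrix_carrier \<open>0 < m\<close>] imageE norm_ge_zero)
    with True show ?thesis by simp
  next
    case False
    then have "\<Psi> ! i \<noteq> 0\<^sub>v m" using assms by auto
    then show ?thesis
      using assms by (intro spectral_radius_ge[OF op_matrix_carrier \<open>0 < m\<close>]) (auto simp: iff)
  qed
qed

section \<open>Weighted frames from a unitary matrix with constant last column\<close>

text \<open>Each bound forces \<open>Re (z i) \<le> 0\<close>, and nonpositive reals with sum zero
  all vanish. The bound then leaves no room for an imaginary part.\<close>

lemma zero_if_cmod_add_le_of_sum_zero:
  fixes z :: "nat \<Rightarrow> complex" and t :: real
  assumes "(\<Sum>i<n. z i) = 0" and le: "\<And>i. i < n \<Longrightarrow> cmod (of_real t + z i) \<le> t" and "i < n"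
  shows "z i = 0"
proof -
  have nonpos: "0 \<le> - Re (z j)" if "j < n" for j
    using le[OF that] complex_Re_le_cmod[of "of_real t + z j"] by simp
  have "(\<Sum>j<n. - Re (z j)) = - Re (\<Sum>j<n. z j)"
    by (simp add: sum_negf)
  then have "(\<Sum>j<n. - Re (z j)) = 0"
    using assms(1) by simp
  then have Re: "Re (z i) = 0"
    using nonpos \<open>i < n\<close> by (subst (asm) sum_nonneg_eq_0_iff) auto
  have "(cmod (of_real t + z i))\<^sup>2 \<le> t\<^sup>2"
    using le[OF \<open>i < n\<close>] by (intro power_mono) auto
  then have "(Im (z i))\<^sup>2 \<le> 0"
    unfolding cmod_power2 using Re by simp
  with Re show ?thesis by (simp add: complex_eq_iff)
qed

text \<open>\<open>a\<close> will hold an orthonormal basis of Laplacian eigenvectors: the columns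
  below \<open>m\<close> for the nonzero eigenvalues, the last column \<open>m\<close> for the
  kernel.\<close>

locale unitary_const_col =
  fixes n m :: nat and a :: "nat \<Rightarrow> nat \<Rightarrow> complex" and c :: complex
  assumes n_eq: "n = Suc m" and m_pos: "0 < m"
    and cols: "\<And>j k. j < n \<Longrightarrow> k < n \<Longrightarrow> (\<Sum>i<n. a i j * cnj (a i k)) = of_bool (j = k)"
    and rows: "\<And>i j. i < n \<Longrightarrow> j < n \<Longrightarrow> (\<Sum>k<n. a i k * cnj (a j k)) = of_bool (i = j)"
    and const_col: "\<And>i. i < n \<Longrightarrow> a i m = c"
begin

lemma n_pos: "0 < n" and less_n: "k < m \<Longrightarrow> k < n"
  by (simp_all add: n_eq)

lemma one_less_n: "1 < n"
  using m_pos by (simp add: n_eq)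

lemma one_minus_inverse_n: "1 - 1 / of_nat n = (of_real (m / n) :: complex)"
proof -
  have "of_real (m / n) = (of_nat n - 1 :: complex) / of_nat n"
    by (simp add: n_eq)
  then show ?thesis using n_pos by (simp add: diff_divide_distrib)
qed

lemma const_mult_cnj: "c * cnj c = 1 / of_nat n"
proof -
  have "of_nat n * (c * cnj c) = 1"
    using cols[of m m] by (simp add: const_col n_eq del: sum.lessThan_Suc)
  then show ?thesis using n_pos by (simp add: field_simps)
qed

text \<open>Column \<open>k\<close> is orthogonal to the last column, whose constant entry
  \<open>c\<close> is nonzero.\<close>

lemma col_sum_zero: assumes "k < m" shows "(\<Sum>i<n. a i k) = 0"
proof -
  have "(\<Sum>i<n. a i k) * cnj c = (\<Sum>i<n. a i k * cnj (a i m))"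
    unfolding sum_distrib_right by (intro sum.cong refl) (simp add: const_col)
  also have "\<dots> = 0" using cols[of k m] assms n_eq by simp
  moreover have "c \<noteq> 0" using const_mult_cnj n_pos by auto
  ultimately show ?thesis by simp
qed

text \<open>Removing the last term \<open>c * cnj c\<close> from the full row product leaves the
  orthogonal projection onto the complement of the all-ones vector.\<close>

lemma rows_truncated:
  assumes "i < n" "j < n"
  shows "(\<Sum>k<m. a i k * cnj (a j k)) = of_bool (i = j) - 1 / of_nat n"
  using rows[OF assms] const_mult_cnj assms by (simp add: n_eq const_col algebra_simps)

text \<open>With \<open>w k = sqrt (l k)\<close> this is the \<open>L\<^sub>G\<close>-frame built from the nonzero Laplacian eigenvalues
  \<open>l k\<close>; inverting the weights gives its canonical dual.\<close>

definition weighted :: "(nat \<Rightarrow> real) \<Rightarrow> complex vec list" where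
  "weighted w = map (\<lambda>i. vec m (\<lambda>k. of_real (w k) * cnj (a i k))) [0..<n]"

lemma length_weighted [simp]: "length (weighted w) = n"
  by (simp add: weighted_def)

lemma weighted_carrier [simp]: "i < n \<Longrightarrow> weighted w ! i \<in> carrier_vec m"
  by (simp add: weighted_def)

lemma dim_weighted [simp]: "i < n \<Longrightarrow> dim_vec (weighted w ! i) = m"
  by (simp add: weighted_def)

lemma weighted_index: "i < n \<Longrightarrow> k < m \<Longrightarrow> weighted w ! i $ k = of_real (w k) * cnj (a i k)"
  by (simp add: weighted_def)

section \<open>Analysis and synthesis with weighted frames\<close>

lemma cscalar_prod_weighted:
  assumes "f \<in> carrier_vec m" "i < n"
  shows "f \<bullet>c weighted w ! i = (\<Sum>p<m. f $ p * of_real (w p) * a i p)"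
  using assms by (simp add: cscalar_prod_sum[of f m] weighted_index mult.assoc)

text \<open>Orthonormal columns leave only the term \<open>p = k\<close>. Two independent weights
  let one identity serve the frame operator, Parseval and reconstruction.\<close>

lemma synthesis_analysis_weighted:
  assumes f: "f \<in> carrier_vec m" and k: "k < m"
  shows "(\<Sum>i<n. (f \<bullet>c weighted w ! i) * weighted w' ! i $ k) = of_real (w k * w' k) * f $ k"
proof -
  have "(\<Sum>i<n. (f \<bullet>c weighted w ! i) * weighted w' ! i $ k)
      = (\<Sum>i<n. \<Sum>p<m. f $ p * of_real (w p * w' k) * (a i p * cnj (a i k)))"
    using f k by (intro sum.cong refl) (simp add: cscalar_prod_weighted weighted_index sum_distrib_left sum_distrib_right mult_ac)
  also have "\<dots> = (\<Sum>p<m. f $ p * of_real (w p * w' k) * (\<Sum>i<n. a i p * cnj (a i k)))"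
    by (subst sum.swap) (simp only: sum_distrib_left)
  also have "\<dots> = (\<Sum>p<m. f $ p * of_real (w p * w' k) * of_bool (p = k))"
    using k by (intro sum.cong refl) (simp add: cols less_n del: of_real_mult)
  also have "\<dots> = (\<Sum>p<m. if p = k then f $ p * of_real (w p * w' k) else 0)"
    by (intro sum.cong refl) simp
  also have "\<dots> = of_real (w k * w' k) * f $ k"
    using k by (simp add: mult_ac)
  finally show ?thesis .
qed

lemma parseval_weighted:
  assumes f: "f \<in> carrier_vec m"
  shows "(\<Sum>i<n. (cmod (f \<bullet>c weighted w ! i))\<^sup>2) = (\<Sum>k<m. (w k)\<^sup>2 * (cmod (f $ k))\<^sup>2)"
proof -
  have "of_real (\<Sum>i<n. (cmod (f \<bullet>c weighted w ! i))\<^sup>2)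
      = (\<Sum>i<n. (f \<bullet>c weighted w ! i) * cnj (\<Sum>k<m. f $ k * cnj (weighted w ! i $ k)))"
    unfolding of_real_sum complex_norm_square
    by (intro sum.cong refl) (simp only: cscalar_prod_sum[OF f weighted_carrier] lessThan_iff)
  also have "\<dots> = (\<Sum>i<n. \<Sum>k<m. cnj (f $ k) * ((f \<bullet>c weighted w ! i) * weighted w ! i $ k))"
    by (simp add: sum_distrib_left mult_ac)
  also have "\<dots> = (\<Sum>k<m. cnj (f $ k) * (\<Sum>i<n. (f \<bullet>c weighted w ! i) * weighted w ! i $ k))"
    by (subst sum.swap) (simp only: sum_distrib_left)
  also have "\<dots> = (\<Sum>k<m. of_real ((w k)\<^sup>2 * (cmod (f $ k))\<^sup>2))"
    by (intro sum.cong refl) (simp add: synthesis_analysis_weighted[OF f] complex_norm_square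
        power2_eq_square[of "w _"] del: of_real_power)
  finally show ?thesis by (simp only: of_real_sum [symmetric] of_real_eq_iff)
qed

lemma reconstruction_weighted:
  assumes "f \<in> carrier_vec m" "\<And>k. k < m \<Longrightarrow> w k * w' k = 1"
  shows "f = finsum_vec TYPE(complex) m (\<lambda>i. (f \<bullet>c weighted w ! i) \<cdot>\<^sub>v weighted w' ! i) {..<n}"
  using assms
  by (subst finsum_smult_vec_eq_iff) (simp_all add: synthesis_analysis_weighted del: of_real_mult)

text \<open>By \<open>parseval_weighted\<close> the least and the greatest
  \<open>(w k)\<^sup>2\<close> are frame bounds; both exist since \<open>m\<close> is
  positive.\<close>

lemma is_frame_weighted:
  assumes "\<And>k. k < m \<Longrightarrow> 0 < w k"
  shows "is_frame m (weighted w)"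
  unfolding is_frame_def
proof (intro conjI exI ballI)
  let ?W = "(\<lambda>k. (w k)\<^sup>2) ` {..<m}"
  have W: "finite ?W" "?W \<noteq> {}" using m_pos by auto
  show "set (weighted w) \<subseteq> carrier_vec m"
    by (auto simp: in_set_conv_nth)
  have "0 < (w k)\<^sup>2" if "k < m" for k
    using assms[OF that] by (rule zero_less_power)
  then show "0 < Min ?W"
    unfolding Min_gr_iff[OF W] by blast
  show "Min ?W \<le> Max ?W" using W by (meson Max_in Min_le)
  fix f :: "complex vec" assume f: "f \<in> carrier_vec m"
  have norm: "Re (f \<bullet>c f) = (\<Sum>k<m. (cmod (f $ k))\<^sup>2)"
    unfolding cscalar_prod_sum[OF f f] complex_norm_square [symmetric] Re_sum Re_complex_of_real ..
  show "Min ?W * Re (f \<bullet>c f) \<le> (\<Sum>i<length (weighted w). (cmod (f \<bullet>c weighted w ! i))\<^sup>2)"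
    using W f unfolding norm sum_distrib_left
    by (auto simp: parseval_weighted intro!: sum_mono mult_right_mono Min_le)
  show "(\<Sum>i<length (weighted w). (cmod (f \<bullet>c weighted w ! i))\<^sup>2) \<le> Max ?W * Re (f \<bullet>c f)"
    using W f unfolding norm sum_distrib_left
    by (auto simp: parseval_weighted intro!: sum_mono mult_right_mono Max_ge)
qed

end

section \<open>Optimality of the canonical dual\<close>

locale laplacian_frame = unitary_const_col +
  fixes w :: "nat \<Rightarrow> real"
  assumes w_pos: "\<And>k. k < m \<Longrightarrow> 0 < w k"
begin

abbreviation "\<Phi> \<equiv> weighted w"
abbreviation "\<Phi>d \<equiv> weighted (\<lambda>k. 1 / w k)"

text \<open>The frame operator is diagonal with nonzero entries \<open>(w k)\<^sup>2\<close>, hence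
  injective, so exhibiting the preimage \<open>\<Phi>d ! i\<close> of \<open>\<Phi> ! i\<close>
  determines the inverse there.\<close>

lemma canonical_dual_eq: "canonical_dual m \<Phi> = \<Phi>d"
proof (rule nth_equalityI)
  show "length (canonical_dual m \<Phi>) = length \<Phi>d"
    by (simp add: canonical_dual_def)
  fix i assume "i < length (canonical_dual m \<Phi>)"
  then have i: "i < n" by (simp add: canonical_dual_def)
  have dim: "dim_vec (frame_op m \<Phi> f) = m" for f
    unfolding frame_op_def by (intro carrier_vecD finsum_smult_vec_closed) simp
  have idx: "frame_op m \<Phi> f $ k = of_real ((w k)\<^sup>2) * f $ k" if "f \<in> carrier_vec m" "k < m" for f k
    unfolding frame_op_def using that
    by (subst index_finsum_smult_vec) (auto simp: synthesis_analysis_weighted power2_eq_square)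
  have "inj_on (frame_op m \<Phi>) (carrier_vec m)"
  proof (rule inj_onI, rule eq_vecI)
    fix f g :: "complex vec"
    assume fg: "f \<in> carrier_vec m" "g \<in> carrier_vec m" "frame_op m \<Phi> f = frame_op m \<Phi> g"
    show "dim_vec f = dim_vec g" using fg by simp
    fix k assume "k < dim_vec g"
    then have k: "k < m" using fg by simp
    have "of_real ((w k)\<^sup>2) * f $ k = of_real ((w k)\<^sup>2) * g $ k"
      unfolding idx[OF fg(1) k, symmetric] idx[OF fg(2) k, symmetric] fg(3) ..
    then show "f $ k = g $ k" using w_pos[OF k] by simp
  qed
  moreover have "frame_op m \<Phi> (\<Phi>d ! i) = \<Phi> ! i"
  proof (rule eq_vecI)
    show "dim_vec (frame_op m \<Phi> (\<Phi>d ! i)) = dim_vec (\<Phi> ! i)"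
      unfolding dim using i by (simp add: weighted_def)
    fix k assume "k < dim_vec (\<Phi> ! i)"
    then have k: "k < m" using i by (simp add: weighted_def)
    show "frame_op m \<Phi> (\<Phi>d ! i) $ k = \<Phi> ! i $ k"
      using i k w_pos[OF k] by (simp add: idx weighted_index power2_eq_square)
  qed
  ultimately have "the_inv_into (carrier_vec m) (frame_op m \<Phi>) (\<Phi> ! i) = \<Phi>d ! i"
    using i by (intro the_inv_into_f_eq) simp_all
  then show "canonical_dual m \<Phi> ! i = \<Phi>d ! i"
    using i by (simp add: canonical_dual_def)
qed

lemma canonical_dual_mem: "\<Phi>d \<in> dual_frames m \<Phi>"
proof -
  have "is_frame m \<Phi>d" using w_pos by (intro is_frame_weighted) simp
  moreover have "w k * (1 / w k) = 1" "1 / w k * w k = 1" if "k < m" for k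
    using w_pos[OF that] by simp_all
  ultimately show ?thesis
    unfolding dual_frames_def by (simp only: mem_Collect_eq length_weighted) (blast intro: reconstruction_weighted)
qed

text \<open>The weights \<open>w p\<close> and \<open>1 / w p\<close> cancel, leaving a truncated
  row product.\<close>

lemma gram_canonical_dual:
  assumes "i < n" "j < n"
  shows "\<Phi>d ! j \<bullet>c \<Phi> ! i = of_bool (i = j) - 1 / of_nat n"
proof -
  have "\<Phi>d ! j \<bullet>c \<Phi> ! i = (\<Sum>p<m. a i p * cnj (a j p))"
    unfolding cscalar_prod_weighted[OF weighted_carrier[OF assms(2)] assms(1)]
    using assms w_pos by (intro sum.cong refl) (force simp: weighted_index field_simps)
  with rows_truncated[OF assms] show ?thesis by simp
qed

section \<open>Dual frames as translates of the canonical one\<close>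

lemma sum_cscalar_prod_zero:
  assumes "h \<in> carrier_vec m"
  shows "(\<Sum>i<n. h \<bullet>c \<Phi> ! i) = 0"
proof -
  have "(\<Sum>i<n. h \<bullet>c \<Phi> ! i) = (\<Sum>p<m. h $ p * of_real (w p) * (\<Sum>i<n. a i p))"
    using assms unfolding sum_distrib_left
    by (subst sum.swap) (simp add: cscalar_prod_weighted)
  then show ?thesis by (simp add: col_sum_zero)
qed

text \<open>The difference of two dual frames synthesises every analysis sequence of
  \<open>\<Phi>\<close> to zero. These sequences span the first \<open>m\<close> columns of
  \<open>a\<close>, so only the constant column is left for each coordinate of the
  difference.\<close>

lemma dual_frame_translate:
  assumes "\<Psi> \<in> dual_frames m \<Phi>"
  obtains h where "h \<in> carrier_vec m" "\<And>i. i < n \<Longrightarrow> \<Psi> ! i = \<Phi>d ! i + h"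
proof -
  have len: "length \<Psi> = n" and "set \<Psi> \<subseteq> carrier_vec m"
    and dual: "\<And>f. f \<in> carrier_vec m \<Longrightarrow>
      f = finsum_vec TYPE(complex) m (\<lambda>i. (f \<bullet>c \<Phi> ! i) \<cdot>\<^sub>v \<Psi> ! i) {..<n}"
    using assms by (simp_all add: dual_frames_def is_frame_def)
  then have car: "\<And>i. i < n \<Longrightarrow> \<Psi> ! i \<in> carrier_vec m"
    by (meson nth_mem subsetD)
  define \<eta> where "\<eta> i k = \<Psi> ! i $ k - \<Phi>d ! i $ k" for i k
  have diff: "(\<Sum>i<n. (f \<bullet>c \<Phi> ! i) * \<eta> i k) = 0" if f: "f \<in> carrier_vec m" and k: "k < m" for f k
  proof -
    have "(\<Sum>i<n. (f \<bullet>c \<Phi> ! i) * \<Psi> ! i $ k) = f $ k"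
      using dual[OF f] car f k by (subst (asm) finsum_smult_vec_eq_iff) auto
    then show ?thesis
      using f k w_pos[OF k] by (simp add: \<eta>_def right_diff_distrib sum_subtractf
          synthesis_analysis_weighted)
  qed
  \<comment> \<open>Analysing a unit vector gives column \<open>p\<close> up to the nonzero factor
    \<open>w p\<close>.\<close>
  have ortho: "(\<Sum>i<n. a i p * \<eta> i k) = 0" if p: "p < m" and k: "k < m" for p k
  proof -
    have "unit_vec m p \<bullet>c \<Phi> ! i = of_real (w p) * a i p" if "i < n" for i
      using scalar_prod_left_unit[OF _ p, of "conjugate (\<Phi> ! i)"] that p by (simp add: weighted_index)
    then have "(\<Sum>i<n. of_real (w p) * (a i p * \<eta> i k)) = 0"
      using diff[OF unit_vec_carrier k, of p] by (simp add: mult.assoc)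
    then show ?thesis
      using w_pos[OF p] by (simp flip: sum_distrib_left)
  qed
  have split: "(\<Sum>p<n. g p) = (\<Sum>p<m. g p) + g m" for g :: "nat \<Rightarrow> complex"
    by (simp add: n_eq)
  \<comment> \<open>Insert row orthonormality; by \<open>ortho\<close> only the last column
    contributes, and \<open>c * cnj c\<close> being \<open>1 / n\<close> turns its term into a mean
    over all indices.\<close>
  have \<eta>: "\<eta> i k = (\<Sum>j<n. \<eta> j k) / of_nat n" if i: "i < n" and k: "k < m" for i k
  proof -
    have "\<eta> i k = (\<Sum>j<n. if j = i then \<eta> j k else 0)"
      using i by simp
    also have "\<dots> = (\<Sum>j<n. (\<Sum>p<n. a j p * cnj (a i p)) * \<eta> j k)"
      using i by (intro sum.cong refl) (simp add: rows)
    also have "\<dots> = (\<Sum>p<n. cnj (a i p) * (\<Sum>j<n. a j p * \<eta> j k))"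
      unfolding sum_distrib_left sum_distrib_right by (subst sum.swap) (simp add: mult_ac)
    also have "\<dots> = cnj (a i m) * (\<Sum>j<n. a j m * \<eta> j k)"
      using k by (simp add: ortho split[of "\<lambda>p. cnj (a i p) * _ p"])
    also have "\<dots> = (c * cnj c) * (\<Sum>j<n. \<eta> j k)"
      using i by (simp add: const_col flip: sum_distrib_left)
    finally show ?thesis by (simp add: const_mult_cnj)
  qed
  show ?thesis
  proof (rule that[of "vec m (\<lambda>k. (\<Sum>j<n. \<eta> j k) / of_nat n)"])
    fix i assume i: "i < n"
    show "\<Psi> ! i = \<Phi>d ! i + vec m (\<lambda>k. (\<Sum>j<n. \<eta> j k) / of_nat n)"
    proof (rule eq_vecI)
      show "dim_vec (\<Psi> ! i) = dim_vec (\<Phi>d ! i + vec m (\<lambda>k. (\<Sum>j<n. \<eta> j k) / of_nat n))"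
        using car[OF i] by simp
      fix k assume "k < dim_vec (\<Phi>d ! i + vec m (\<lambda>k. (\<Sum>j<n. \<eta> j k) / of_nat n))"
      then have "k < m" by simp
      then show "\<Psi> ! i $ k = (\<Phi>d ! i + vec m (\<lambda>k. (\<Sum>j<n. \<eta> j k) / of_nat n)) $ k"
        using \<eta>[OF i, of k] by (simp add: \<eta>_def[of i] diff_eq_eq add.commute)
    qed
  qed simp
qed

lemma dual_frame_carrier:
  assumes "\<Psi> \<in> dual_frames m \<Phi>" "i < n"
  shows "\<Psi> ! i \<in> carrier_vec m"
  using assms unfolding dual_frames_def is_frame_def by (auto dest: nth_mem)

section \<open>One erasure\<close>

lemma erasure_radius_one_canonical_dual: "erasure_radius m \<Phi> 1 \<Phi>d \<le> m / n"
proof (rule erasure_radius_le)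
  show "1 \<le> length \<Phi>" using n_pos by simp
  fix \<Lambda> assume "\<Lambda> \<subseteq> {..<length \<Phi>}" "card \<Lambda> = 1"
  then obtain i where i: "\<Lambda> = {i}" "i < n"
    by (metis card_1_singletonE insert_subset lessThan_iff length_weighted)
  then show "spectral_radius (op_matrix m (error_op m \<Phi> \<Phi>d \<Lambda>)) \<le> m / n"
    using spectral_radius_error_op_singleton[OF m_pos, of \<Phi> i \<Phi>d] gram_canonical_dual[of i i]
    by (simp add: one_minus_inverse_n norm_divide)
qed

lemma dual_frame_unique_one:
  assumes \<Psi>: "\<Psi> \<in> dual_frames m \<Phi>" and le: "erasure_radius m \<Phi> 1 \<Psi> \<le> m / n"
  shows "\<Psi> = \<Phi>d"
proof -
  obtain h where h: "h \<in> carrier_vec m" "\<And>i. i < n \<Longrightarrow> \<Psi> ! i = \<Phi>d ! i + h"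
    using dual_frame_translate[OF \<Psi>] by blast
  \<comment> \<open>The number \<open>t\<close> is the diagonal Gram entry \<open>m / n\<close>,
    that is \<open>1 - 1 / n\<close>.\<close>
  have "h \<bullet>c \<Phi> ! i = 0" if "i < n" for i
  proof (rule zero_if_cmod_add_le_of_sum_zero[OF sum_cscalar_prod_zero[OF h(1)] _ that])
    fix i assume i: "i < n"
    have "cmod (\<Psi> ! i \<bullet>c \<Phi> ! i) = spectral_radius (op_matrix m (error_op m \<Phi> \<Psi> {i}))"
      using i \<Psi> m_pos by (simp add: spectral_radius_error_op_singleton dual_frame_carrier)
    also have "\<dots> \<le> erasure_radius m \<Phi> 1 \<Psi>"
      using i by (intro erasure_radius_ge) auto
    also note le
    also have "\<Psi> ! i \<bullet>c \<Phi> ! i = \<Phi>d ! i \<bullet>c \<Phi> ! i + h \<bullet>c \<Phi> ! i"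
      using i h by (simp add: add_scalar_prod_distrib[of _ m])
    also have "\<Phi>d ! i \<bullet>c \<Phi> ! i = of_real (m / n)"
      using i by (simp add: gram_canonical_dual one_minus_inverse_n del: of_real_divide)
    finally show "cmod (of_real (m / n) + h \<bullet>c \<Phi> ! i) \<le> m / n" .
  qed
  \<comment> \<open>Synthesising the vanishing coefficients of \<open>h\<close> with
    \<open>\<Phi>d\<close> gives back \<open>h\<close>.\<close>
  then have "of_real (w k * (1 / w k)) * h $ k = 0" if "k < m" for k
    using synthesis_analysis_weighted[OF h(1) that, of w "\<lambda>k. 1 / w k"] by simp
  then have "h $ k = 0" if "k < m" for k
    using w_pos that by force
  then have "h = 0\<^sub>v m" using h(1) by (intro eq_vecI) auto
  moreover have "length \<Psi> = n" using \<Psi> by (simp add: dual_frames_def)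
  ultimately show ?thesis
    using h(2) by (intro nth_equalityI) auto
qed

section \<open>Several erasures\<close>

lemma erasure_radius_canonical_dual:
  assumes "r \<le> n"
  shows "erasure_radius m \<Phi> r \<Phi>d \<le> 1"
proof (rule erasure_radius_le)
  show "r \<le> length \<Phi>" using assms by simp
  fix \<Lambda> assume \<Lambda>: "\<Lambda> \<subseteq> {..<length \<Phi>}"
  then have fin: "finite \<Lambda>" and lt: "\<And>i. i \<in> \<Lambda> \<Longrightarrow> i < n" by (auto intro: finite_subset)
  \<comment> \<open>Pairing the eigenvector equation for \<open>f\<close> with \<open>S f\<close>, \<open>S\<close> the frame operator, exhibits the
    eigenvalue as the ratio of a partial sum of \<open>\<Sum>\<^sub>i |\<langle>f, \<phi>\<^sub>i\<rangle>|\<^sup>2\<close> to the full sum.\<close>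
  show "spectral_radius (op_matrix m (error_op m \<Phi> \<Phi>d \<Lambda>)) \<le> 1"
  proof (rule spectral_radius_le[OF op_matrix_carrier m_pos])
    fix x assume "eigenvalue (op_matrix m (error_op m \<Phi> \<Phi>d \<Lambda>)) x"
    then obtain f where f: "f \<in> carrier_vec m" "f \<noteq> 0\<^sub>v m"
      and eig: "\<And>k. k < m \<Longrightarrow> (\<Sum>i\<in>\<Lambda>. (f \<bullet>c \<Phi> ! i) * \<Phi>d ! i $ k) = x * f $ k"
      using eigenvalue_error_op_iff[OF fin, of \<Phi> m \<Phi>d] lt by auto
    define S where "S = (\<Sum>i<n. (cmod (f \<bullet>c \<Phi> ! i))\<^sup>2)"
    define T where "T = (\<Sum>i\<in>\<Lambda>. (cmod (f \<bullet>c \<Phi> ! i))\<^sup>2)"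
    have S: "S = (\<Sum>k<m. (w k)\<^sup>2 * (cmod (f $ k))\<^sup>2)"
      unfolding S_def by (rule parseval_weighted[OF f(1)])
    obtain k where k: "k < m" "f $ k \<noteq> 0"
      using f by (metis carrier_vecD eq_vecI index_zero_vec)
    have "0 < (w k)\<^sup>2 * (cmod (f $ k))\<^sup>2" using k w_pos[OF k(1)] by simp
    also have "\<dots> \<le> S"
      unfolding S using k(1) by (intro member_le_sum) auto
    finally have "0 < S" .
    have "0 \<le> T" unfolding T_def by (intro sum_nonneg) simp
    have "T \<le> S"
      unfolding T_def S_def using \<Lambda> by (intro sum_mono2) auto
    have "x * of_real S = (\<Sum>k<m. (w k)\<^sup>2 * cnj (f $ k) * (x * f $ k))"
      unfolding S of_real_sum of_real_mult complex_norm_square by (simp add: sum_distrib_left mult_ac)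
    also have "\<dots> = (\<Sum>k<m. (w k)\<^sup>2 * cnj (f $ k) * (\<Sum>i\<in>\<Lambda>. (f \<bullet>c \<Phi> ! i) * \<Phi>d ! i $ k))"
      by (intro sum.cong refl) (simp only: eig lessThan_iff)
    \<comment> \<open>The factor \<open>(w k)\<^sup>2\<close> turns the weight
      \<open>1 / w k\<close> of \<open>\<Phi>d\<close> into the weight \<open>w k\<close> of
      \<open>\<Phi>\<close>.\<close>
    also have "\<dots> = (\<Sum>k<m. \<Sum>i\<in>\<Lambda>. (f \<bullet>c \<Phi> ! i) * (cnj (f $ k) * \<Phi> ! i $ k))"
      unfolding sum_distrib_left
    proof (intro sum.cong refl)
      fix k i assume "k \<in> {..<m}" "i \<in> \<Lambda>"
      then show "(w k)\<^sup>2 * cnj (f $ k) * ((f \<bullet>c \<Phi> ! i) * \<Phi>d ! i $ k)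
          = (f \<bullet>c \<Phi> ! i) * (cnj (f $ k) * \<Phi> ! i $ k)"
        using w_pos[of k] lt[of i] by (simp add: weighted_index power2_eq_square)
    qed
    also have "\<dots> = (\<Sum>i\<in>\<Lambda>. (f \<bullet>c \<Phi> ! i) * (\<Sum>k<m. cnj (f $ k) * \<Phi> ! i $ k))"
      unfolding sum_distrib_left by (rule sum.swap)
    also have "\<dots> = (\<Sum>i\<in>\<Lambda>. (f \<bullet>c \<Phi> ! i) * cnj (f \<bullet>c \<Phi> ! i))"
      using f(1) lt by (intro sum.cong refl) (simp add: cscalar_prod_sum[of f m])
    also have "\<dots> = of_real T"
      unfolding T_def of_real_sum complex_norm_square ..
    finally have "x = of_real (T / S)" using \<open>0 < S\<close> by (simp add: field_simps)
    then have "cmod x = T / S" using \<open>0 < S\<close> \<open>0 \<le> T\<close> by (simp add: norm_divide)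
    then show "cmod x \<le> 1" using \<open>0 < S\<close> \<open>T \<le> S\<close> by simp
  qed
qed

lemma erasure_radius_dual_frame_ge:
  assumes \<Psi>: "\<Psi> \<in> dual_frames m \<Phi>" and r: "1 < r" "r \<le> n"
  shows "1 \<le> erasure_radius m \<Phi> r \<Psi>"
proof -
  obtain h where h: "h \<in> carrier_vec m" "\<And>i. i < n \<Longrightarrow> \<Psi> ! i = \<Phi>d ! i + h"
    using dual_frame_translate[OF \<Psi>] by blast
  \<comment> \<open>\<open>f = \<Psi> ! 0 - \<Psi> ! 1\<close> as the translation cancels, so the erasure of \<open>{..<r}\<close> fixes \<open>f\<close>.\<close>
  define f where "f = \<Phi>d ! 0 - \<Phi>d ! 1"
  have lt: "0 < n" "1 < n" and f: "f \<in> carrier_vec m"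
    using r by (auto simp: f_def)
  \<comment> \<open>The terms \<open>1 / n\<close> of the two Gram entries cancel.\<close>
  have coeff: "f \<bullet>c \<Phi> ! i = of_bool (i = 0) - of_bool (i = 1)" if "i < n" for i
    using lt that unfolding f_def
    by (simp add: minus_scalar_prod_distrib[of _ m] gram_canonical_dual)
  have "f \<noteq> 0\<^sub>v m" using coeff[of 0] lt(1) by auto
  moreover have "(\<Sum>i<r. (f \<bullet>c \<Phi> ! i) * \<Psi> ! i $ k) = 1 * f $ k" if k: "k < m" for k
  proof -
    have "(\<Sum>i<r. (f \<bullet>c \<Phi> ! i) * \<Psi> ! i $ k)
        = (\<Sum>i<r. (if i = 0 then \<Psi> ! i $ k else 0) - (if i = 1 then \<Psi> ! i $ k else 0))"
      using r by (intro sum.cong refl) (simp add: coeff)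
    \<comment> \<open>Since \<open>1 < r\<close>, both indices \<open>0\<close> and \<open>1\<close>
      are erased.\<close>
    also have "\<dots> = \<Psi> ! 0 $ k - \<Psi> ! 1 $ k"
      using r by (simp add: sum_subtractf)
    also have "\<dots> = f $ k"
      using h lt k by (simp add: f_def)
    finally show ?thesis by simp
  qed
  ultimately have "eigenvalue (op_matrix m (error_op m \<Phi> \<Psi> {..<r})) 1"
    using eigenvalue_error_op_iff[of "{..<r}" \<Phi> m \<Psi>] f r dual_frame_carrier[OF \<Psi>] by auto
  from spectral_radius_ge[OF op_matrix_carrier m_pos this]
  have "1 \<le> spectral_radius (op_matrix m (error_op m \<Phi> \<Psi> {..<r}))" by simp
  also have "\<dots> \<le> erasure_radius m \<Phi> r \<Psi>"
    using r by (intro erasure_radius_ge) auto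
  finally show ?thesis .
qed

section \<open>Spectrally optimal dual frames\<close>

lemma SOD_frame_one_iff: "SOD_frame m \<Phi> 1 \<Psi> \<longleftrightarrow> \<Psi> = \<Phi>d"
proof
  assume "SOD_frame m \<Phi> 1 \<Psi>"
  then have "is_arg_min (erasure_radius m \<Phi> 1) (\<lambda>\<Psi>. \<Psi> \<in> dual_frames m \<Phi>) \<Psi>"
    by (cases rule: SOD_frame.cases) auto
  then have "\<Psi> \<in> dual_frames m \<Phi>" "erasure_radius m \<Phi> 1 \<Psi> \<le> erasure_radius m \<Phi> 1 \<Phi>d"
    using canonical_dual_mem by (auto simp: is_arg_min_def not_less)
  then show "\<Psi> = \<Phi>d"
    using dual_frame_unique_one erasure_radius_one_canonical_dual by force
next
  \<comment> \<open>A dual frame with smaller radius would also obey the bound \<open>m / n\<close>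
    and hence equal \<open>\<Phi>d\<close>, which is absurd.\<close>
  have "is_arg_min (erasure_radius m \<Phi> 1) (\<lambda>\<Psi>. \<Psi> \<in> dual_frames m \<Phi>) \<Phi>d"
    using canonical_dual_mem dual_frame_unique_one erasure_radius_one_canonical_dual
    unfolding is_arg_min_def by (metis dual_order.strict_trans1 less_irrefl less_imp_le)
  moreover assume "\<Psi> = \<Phi>d"
  ultimately show "SOD_frame m \<Phi> 1 \<Psi>"
    using SOD_frame.one[of \<Phi> m \<Phi>d] one_less_n by simp
qed

text \<open>Uniqueness is inherited, as optimality for \<open>Suc r\<close> erasures includes
  optimality for \<open>r\<close>. Existence holds because the upper bound 1 for
  \<open>\<Phi>d\<close> meets the lower bound 1 for all dual frames.\<close>

lemma SOD_frame_iff: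
  assumes "1 \<le> r" "r \<le> m"
  shows "SOD_frame m \<Phi> r \<Psi> \<longleftrightarrow> \<Psi> = \<Phi>d"
  using assms
proof (induction r rule: dec_induct)
  case base
  show ?case by (rule SOD_frame_one_iff)
next
  case (step r)
  then have IH: "SOD_frame m \<Phi> r \<Psi> \<longleftrightarrow> \<Psi> = \<Phi>d" by simp
  show ?case
  proof
    assume "SOD_frame m \<Phi> (Suc r) \<Psi>"
    then show "\<Psi> = \<Phi>d"
      using IH step.hyps by (cases rule: SOD_frame.cases) auto
  next
    assume "\<Psi> = \<Phi>d"
    have "is_arg_min (erasure_radius m \<Phi> (Suc r)) (\<lambda>\<Psi>. \<Psi> \<in> dual_frames m \<Phi>) \<Phi>d"
      unfolding is_arg_min_def
    proof (intro conjI notI canonical_dual_mem, elim exE conjE)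
      fix \<Psi>' assume \<Psi>': "\<Psi>' \<in> dual_frames m \<Phi>"
        and lt: "erasure_radius m \<Phi> (Suc r) \<Psi>' < erasure_radius m \<Phi> (Suc r) \<Phi>d"
      have "Suc r \<le> n" "1 < Suc r" using step n_eq by auto
      from erasure_radius_dual_frame_ge[OF \<Psi>' this(2,1)] erasure_radius_canonical_dual[OF this(1)] lt
      show False by linarith
    qed
    moreover have "SOD_frame m \<Phi> (Suc r - 1) \<Phi>d"
      using IH \<open>\<Psi> = \<Phi>d\<close> by simp
    moreover have "1 < Suc r" using step.hyps by simp
    \<comment> \<open>The length is \<open>Suc m\<close>, so \<open>Suc r \<le> m\<close> gives the
      strict inequality.\<close>
    moreover have "Suc r < length \<Phi>"
      using step.prems n_eq unfolding length_weighted by linarith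
    ultimately show "SOD_frame m \<Phi> (Suc r) \<Psi>"
      unfolding \<open>\<Psi> = \<Phi>d\<close> by (metis SOD_frame.step)
  qed
qed

end

section \<open>Laplacians\<close>

lemma mat_adjoint_index:
  assumes "i < dim_col A" "j < dim_row A"
  shows "mat_adjoint A $$ (i, j) = conjugate (A $$ (j, i))"
  using assms by (simp add: mat_adjoint_def mat_of_rows_index)

lemma mat_adjoint_carrier: "A \<in> carrier_mat p q \<Longrightarrow> mat_adjoint A \<in> carrier_mat q p"
  by (auto simp: mat_adjoint_def)

lemma out_degree_eq_sum:
  fixes n :: nat
  assumes "pair_graph G" and v: "bij_betw v {..<n} (pverts G)" and i: "i < n"
  shows "out_degree (with_proj G) (v i) = (\<Sum>j<n. of_bool ((v i, v j) \<in> parcs G))"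
proof -
  interpret pair_graph G by fact
  have "out_arcs (with_proj G) (v i) = (\<lambda>j. (v i, v j)) ` {j \<in> {..<n}. (v i, v j) \<in> parcs G}"
  proof (intro equalityI subsetI)
    fix e assume "e \<in> out_arcs (with_proj G) (v i)"
    then have e: "e \<in> parcs G" "fst e = v i" by (simp_all add: out_arcs_def with_proj_def)
    then have "snd e \<in> v ` {..<n}"
      using arc_snd_in_verts v by (simp add: bij_betw_def)
    with e obtain j where "j < n" "e = (v i, v j)"
      by (metis imageE lessThan_iff prod.collapse)
    with e show "e \<in> (\<lambda>j. (v i, v j)) ` {j \<in> {..<n}. (v i, v j) \<in> parcs G}"
      by (intro image_eqI[of _ _ j]) simp_all
  qed (auto simp: out_arcs_def with_proj_def)
  moreover have "inj_on (\<lambda>j. (v i, v j)) {j \<in> {..<n}. (v i, v j) \<in> parcs G}"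
    using v by (auto simp: bij_betw_def inj_on_def)
  ultimately show ?thesis
    by (simp add: out_degree_def card_image Int_def)
qed

lemma laplacian_index:
  assumes "pair_graph G" "bij_betw v {..<n} (pverts G)" "i < n" "j < n"
  shows "laplacian n G v $$ (i, j) =
    of_bool (i = j) * (\<Sum>k<n. of_bool ((v i, v k) \<in> parcs G)) - of_bool ((v i, v j) \<in> parcs G)"
  using assms by (auto simp: laplacian_def mat_diag_def out_degree_eq_sum simp del: sum_of_bool_eq)

text \<open>The degree on the diagonal cancels the count of neighbours; this puts the all-ones
  vector into the kernel.\<close>

lemma laplacian_row_sum:
  assumes "pair_graph G" "bij_betw v {..<n} (pverts G)" "i < n"
  shows "(\<Sum>j<n. laplacian n G v $$ (i, j)) = 0"
proof -
  have "(\<Sum>j<n. laplacian n G v $$ (i, j)) = (\<Sum>j<n. (if j = i then (\<Sum>k<n. of_bool ((v i, v k) \<in> parcs G)) else 0)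
      - of_bool ((v i, v j) \<in> parcs G))"
    by (intro sum.cong refl) (simp add: laplacian_index[OF assms])
  then show ?thesis
    using assms(3) by (simp add: sum_subtractf del: sum_of_bool_eq)
qed

text \<open>Used to see that the nonzero eigenvalues are positive. The division by 2 is there
  because ordered pairs meet each edge twice.\<close>

lemma laplacian_quadratic_form:
  assumes G: "pair_graph G" and v: "bij_betw v {..<n} (pverts G)"
  shows "(\<Sum>i<n. \<Sum>j<n. cnj (x i) * laplacian n G v $$ (i, j) * x j)
    = of_real ((\<Sum>i<n. \<Sum>j<n. of_bool ((v i, v j) \<in> parcs G) * (cmod (x i - x j))\<^sup>2) / 2)"
proof -
  interpret pair_graph G by fact
  define A :: "nat \<Rightarrow> nat \<Rightarrow> complex" where "A i j = of_bool ((v i, v j) \<in> parcs G)" for i j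
  have A_sym: "A i j = A j i" for i j
    using arcs_symmetric by (auto simp: A_def)
  define D where "D = (\<Sum>i<n. \<Sum>j<n. A i j * (cnj (x i) * x i))"
  define E where "E = (\<Sum>i<n. \<Sum>j<n. A i j * (cnj (x i) * x j))"
  \<comment> \<open>Symmetry of adjacency supplies second copies of \<open>D\<close> and
    \<open>E\<close>, which complete the square.\<close>
  have D: "(\<Sum>i<n. \<Sum>j<n. A i j * (cnj (x j) * x j)) = D"
    unfolding D_def by (subst sum.swap) (intro sum.cong refl, simp add: A_sym)
  have E: "(\<Sum>i<n. \<Sum>j<n. A i j * (cnj (x j) * x i)) = E"
    unfolding E_def by (subst sum.swap) (intro sum.cong refl, simp add: A_sym)
  have "(\<Sum>i<n. \<Sum>j<n. cnj (x i) * laplacian n G v $$ (i, j) * x j) = D - E"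
    unfolding D_def E_def sum_subtractf [symmetric]
  proof (rule sum.cong[OF refl])
    fix i assume "i \<in> {..<n}"
    then have "(\<Sum>j<n. cnj (x i) * laplacian n G v $$ (i, j) * x j)
        = (\<Sum>j<n. (if j = i then (\<Sum>k<n. A i k) * (cnj (x i) * x i) else 0) - A i j * (cnj (x i) * x j))"
      by (intro sum.cong refl) (simp add: laplacian_index[OF G v] A_def algebra_simps)
    also have "\<dots> = (\<Sum>k<n. A i k) * (cnj (x i) * x i) - (\<Sum>j<n. A i j * (cnj (x i) * x j))"
      using \<open>i \<in> {..<n}\<close> by (simp add: sum_subtractf)
    finally show "(\<Sum>j<n. cnj (x i) * laplacian n G v $$ (i, j) * x j)
        = (\<Sum>j<n. A i j * (cnj (x i) * x i) - A i j * (cnj (x i) * x j))"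
      by (simp add: sum_subtractf sum_distrib_right)
  qed
  also have "\<dots> = (D + D - E - E) / 2" by simp
  also have "D + D - E - E = (\<Sum>i<n. \<Sum>j<n. A i j * (cnj (x i) * x i)) +
      (\<Sum>i<n. \<Sum>j<n. A i j * (cnj (x j) * x j)) - (\<Sum>i<n. \<Sum>j<n. A i j * (cnj (x i) * x j)) -
      (\<Sum>i<n. \<Sum>j<n. A i j * (cnj (x j) * x i))"
    unfolding D E by (simp only: D_def E_def)
  also have "\<dots> = (\<Sum>i<n. \<Sum>j<n. A i j * ((x i - x j) * cnj (x i - x j)))"
    unfolding sum_subtractf [symmetric] sum.distrib [symmetric]
    by (intro sum.cong refl) (simp add: algebra_simps)
  also have "\<dots> = of_real (\<Sum>i<n. \<Sum>j<n. of_bool ((v i, v j) \<in> parcs G) * (cmod (x i - x j))\<^sup>2)"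
    unfolding of_real_sum of_real_mult complex_norm_square A_def by (intro sum.cong refl) simp
  finally show ?thesis by simp
qed

text \<open>Only one column of \<open>M\<close> lies beyond the first \<open>m\<close>; as those are
  orthogonal to the all-ones vector, the last one must be constant.\<close>

lemma laplacian_frame_of_LG_frame:
  assumes "is_LG_frame n m G \<Phi>" and n_eq: "n = Suc m" and m_pos: "0 < m"
  obtains a c w where "laplacian_frame n m a c w" "\<Phi> = unitary_const_col.weighted n m a w"
proof -
  from assms(1) obtain v M l where G: "pair_graph G" and v: "bij_betw v {..<n} (pverts G)"
    and M: "unitary_mat n M" and l: "\<And>i. i < m \<Longrightarrow> l i \<noteq> (0::real)"
    and L: "laplacian n G v =
      M * mat_diag n (\<lambda>i. if i < m then complex_of_real (l i) else 0) * mat_adjoint M"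
    and \<Phi>: "\<Phi> = map (\<lambda>i. (mat_diag m (\<lambda>i. complex_of_real (sqrt (l i))) *
      mat_adjoint (mat n m (\<lambda>(i, j). M $$ (i, j)))) *\<^sub>v unit_vec n i) [0..<n]"
    unfolding is_LG_frame_def Let_def by blast
  define a where "a i j = M $$ (i, j)" for i j
  have Mc: "M \<in> carrier_mat n n" and Ml: "M * mat_adjoint M = 1\<^sub>m n" and Mr: "mat_adjoint M * M = 1\<^sub>m n"
    using M by (simp_all add: unitary_mat_def)
  note Ac = mat_adjoint_carrier[OF Mc]
  have adj: "mat_adjoint M $$ (i, j) = cnj (a j i)" if "i < n" "j < n" for i j
    using mat_adjoint_index[of i M j] Mc that by (simp add: a_def)
  have rows: "(\<Sum>k<n. a i k * cnj (a j k)) = of_bool (i = j)" if "i < n" "j < n" for i j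
  proof -
    have "(\<Sum>k<n. a i k * cnj (a j k)) = (M * mat_adjoint M) $$ (i, j)"
      using Mc Ac that by (simp add: scalar_prod_def lessThan_atLeast0 adj a_def)
    also have "\<dots> = of_bool (i = j)" using that by (simp add: Ml)
    finally show ?thesis .
  qed
  have cols: "(\<Sum>i<n. a i j * cnj (a i k)) = of_bool (j = k)" if "j < n" "k < n" for j k
  proof -
    have "(\<Sum>i<n. a i j * cnj (a i k)) = (mat_adjoint M * M) $$ (k, j)"
      using Mc Ac that by (simp add: scalar_prod_def lessThan_atLeast0 adj a_def mult.commute)
    also have "\<dots> = of_bool (j = k)" using that by (auto simp: Mr)
    finally show ?thesis .
  qed
  define d where "d k = (if k < m then complex_of_real (l k) else 0)" for k
  have L_index: "laplacian n G v $$ (i, j) = (\<Sum>k<n. a i k * d k * cnj (a j k))"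
    if "i < n" "j < n" for i j
    unfolding L d_def[symmetric] mat_diag_mult_right[OF Mc]
    using Mc Ac that by (simp add: scalar_prod_def lessThan_atLeast0 adj a_def)
  \<comment> \<open>Orthonormal columns collapse the spectral decomposition, so conjugated columns
    are left eigenvectors.\<close>
  have eigen: "(\<Sum>i<n. cnj (a i k) * laplacian n G v $$ (i, j)) = d k * cnj (a j k)"
    if "k < n" "j < n" for k j
  proof -
    have "(\<Sum>i<n. cnj (a i k) * laplacian n G v $$ (i, j))
        = (\<Sum>i<n. \<Sum>p<n. d p * cnj (a j p) * (a i p * cnj (a i k)))"
      using that by (intro sum.cong refl) (simp add: L_index sum_distrib_left mult_ac)
    also have "\<dots> = (\<Sum>p<n. d p * cnj (a j p) * (\<Sum>i<n. a i p * cnj (a i k)))"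
      by (subst sum.swap) (simp only: sum_distrib_left)
    also have "\<dots> = (\<Sum>p<n. if p = k then d p * cnj (a j p) else 0)"
      using that by (intro sum.cong refl) (simp add: cols)
    finally show ?thesis using that by simp
  qed
  \<comment> \<open>The quadratic form at column \<open>k\<close> equals \<open>l k\<close>, so
    \<open>l k\<close> is nonnegative, and it is nonzero by assumption. The weights
    \<open>sqrt (l k)\<close> are therefore positive.\<close>
  have l_pos: "0 < l k" if "k < m" for k
  proof -
    have k: "k < n" using that n_eq by simp
    define q where "q = (\<Sum>i<n. \<Sum>j<n. of_bool ((v i, v j) \<in> parcs G) * (cmod (a i k - a j k))\<^sup>2) / 2"
    have "of_real q = (\<Sum>i<n. \<Sum>j<n. cnj (a i k) * laplacian n G v $$ (i, j) * a j k)"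
      unfolding q_def by (rule laplacian_quadratic_form[OF G v, symmetric])
    also have "\<dots> = (\<Sum>j<n. (\<Sum>i<n. cnj (a i k) * laplacian n G v $$ (i, j)) * a j k)"
      unfolding sum_distrib_right by (rule sum.swap)
    also have "\<dots> = d k * (\<Sum>j<n. a j k * cnj (a j k))"
      unfolding sum_distrib_left using k by (intro sum.cong refl) (simp add: eigen)
    also have "\<dots> = of_real (l k)"
      using k that by (simp add: cols d_def)
    finally have "q = l k" by (simp only: of_real_eq_iff)
    moreover have "0 \<le> q" unfolding q_def by (intro divide_nonneg_nonneg sum_nonneg) auto
    ultimately show ?thesis using l[OF that] by simp
  qed
  \<comment> \<open>The coefficient of the all-ones vector along column \<open>k\<close>.\<close>
  define t where "t k = (\<Sum>j<n. cnj (a j k))" for k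
  have t_zero: "t k = 0" if "k < m" for k
  proof -
    have k: "k < n" using that n_eq by simp
    \<comment> \<open>Summing \<open>eigen\<close> over \<open>j\<close> produces the vanishing row
      sums, while \<open>d k\<close> is nonzero.\<close>
    have "d k * t k = (\<Sum>j<n. \<Sum>i<n. cnj (a i k) * laplacian n G v $$ (i, j))"
      unfolding t_def sum_distrib_left using k by (intro sum.cong refl) (simp add: eigen)
    also have "\<dots> = (\<Sum>i<n. cnj (a i k) * (\<Sum>j<n. laplacian n G v $$ (i, j)))"
      unfolding sum_distrib_left by (rule sum.swap)
    also have "\<dots> = 0" by (simp add: laplacian_row_sum[OF G v])
    finally show ?thesis using l that by (simp add: d_def)
  qed
  have const: "a i m = 1 / t m" if "i < n" for i
  proof -
    \<comment> \<open>Expand the all-ones vector in the columns: only column \<open>m\<close>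
      survives, so \<open>a i m * t m\<close> is 1, which also shows that \<open>t m\<close> is
      nonzero.\<close>
    have "1 = (\<Sum>j<n. if j = i then 1 else 0 :: complex)" using that by simp
    also have "\<dots> = (\<Sum>j<n. \<Sum>k<n. a i k * cnj (a j k))"
      using that by (intro sum.cong refl) (simp add: rows)
    also have "\<dots> = (\<Sum>k<n. a i k * t k)"
      unfolding t_def sum_distrib_left by (rule sum.swap)
    also have "{..<n} = insert m {..<m}" unfolding n_eq by (rule lessThan_Suc)
    also have "(\<Sum>k\<in>insert m {..<m}. a i k * t k) = a i m * t m"
      by (simp add: t_zero)
    finally show ?thesis by (metis mult_not_zero nonzero_eq_divide_eq zero_neq_one)
  qed
  have basis: "unitary_const_col n m a (1 / t m)"
    by unfold_locales (use n_eq m_pos cols rows const in auto)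
  show ?thesis
  proof (rule that)
    show "laplacian_frame n m a (1 / t m) (\<lambda>k. sqrt (l k))"
      using basis l_pos by (simp add: laplacian_frame_def laplacian_frame_axioms_def)
    show "\<Phi> = unitary_const_col.weighted n m a (\<lambda>k. sqrt (l k))"
      unfolding \<Phi> unitary_const_col.weighted_def[OF basis]
    proof (intro map_cong refl eq_vecI)
      fix i k assume "i \<in> set [0..<n]"
        and "k < dim_vec (vec m (\<lambda>k. of_real (sqrt (l k)) * cnj (a i k)))"
      then have i: "i < n" and k: "k < m" by simp_all
      let ?M1 = "mat n m (\<lambda>(i, j). M $$ (i, j))"
      have "mat_adjoint ?M1 \<in> carrier_mat m n" by (rule mat_adjoint_carrier) simp
      from mat_diag_mult_left[OF this] i k
      show "((mat_diag m (\<lambda>i. complex_of_real (sqrt (l i))) * mat_adjoint ?M1) *\<^sub>v unit_vec n i) $ k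
          = vec m (\<lambda>k. of_real (sqrt (l k)) * cnj (a i k)) $ k"
        by (simp add: mat_adjoint_index a_def)
    qed (simp add: mat_diag_def)
  qed
qed

theorem theorem3p5:
  fixes n r :: nat and G :: "'v pair_pre_digraph" and \<Phi> :: "complex vec list"
  assumes "pair_graph G" and "connected (with_proj G)" and "card (pverts G) = n"
    and "is_LG_frame n (n - 1) G \<Phi>"
    and "r \<in> {1..n - 1}"
  shows "SOD_frame (n - 1) \<Phi> r (canonical_dual (n - 1) \<Phi>) \<and>
    (\<forall>\<Psi>. SOD_frame (n - 1) \<Phi> r \<Psi> \<longrightarrow> \<Psi> = canonical_dual (n - 1) \<Phi>)"
proof -
  \<comment> \<open>The existence of \<open>r\<close> forces \<open>n \<ge> 2\<close>, so the
    dimension \<open>n - 1\<close> is positive.\<close>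
  have "n = Suc (n - 1)" "0 < n - 1" using assms(5) by auto
  with assms(4) obtain a c w where frame: "laplacian_frame n (n - 1) a c w"
    and \<Phi>: "\<Phi> = unitary_const_col.weighted n (n - 1) a w"
    by (rule laplacian_frame_of_LG_frame)
  interpret laplacian_frame n "n - 1" a c w by (rule frame)
  show ?thesis
    unfolding \<Phi> canonical_dual_eq using SOD_frame_iff[of r] assms(5) by simp
qed

end
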